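(* Let $n\ge2$ and let $$\Delta(t)=a_0-a_1(t+t^{-1})+a_2(t^2+t^{-2})-\cdots+(-1)^n a_n(t^n+t^{-n})$$ be the Alexander polynomial of a two-bridge knot, normalized so that all the $a_i$ are positive. If $a_n\ne1$, then $$a_{n-2}\le(8n^2-15n+8)\,a_n+2n-1.$$ This bound is sharp (equality is attained by some two-bridge knot with $a_n\neq 1$).
   Context: The Alexander polynomial of a knot $K$ is $\Delta_K(t)=\pm\nabla_K(t^{1/2}-t^{-1/2})$, where $\nabla_K(z)$ is the Conway polynomial, defined by $\nabla_{\text{unknot}}=1$ and $\nabla_{L_+}-\nabla_{L_-}=z\nabla_{L_0}$; the sign is chosen so that $a_n>0$, and for two-bridge knots all $a_i$ are then positive integers. Two-bridge knots: for nonzero integers $b_1,\dots,b_m$ ($m\ge 0$), $C(2b_1,-2b_2,\dots,(-1)^{m-1}2b_m)$ denotes the two-bridge link in Conway normal form with these numbers of signed crossings in its successive twist regions (its Schubert fraction is the continued fraction $[2b_1,-2b_2,\dots,(-1)^{m-1}2b_m]$, where $[a_1,\dots,a_n]=a_1+1/(a_2+1/(\cdots+1/a_n))$). Oriented so that the two strands of each twist region are antiparallel, these give every oriented two-bridge link; it is a knot if and only if $m$ is even. It is known (Siebenmann; Cromwell) that the Conway polynomial of $C(2b_1,-2b_2,\dots,(-1)^{m-1}2b_m)$ is the Euler continuant polynomial $D_m(b_1,\dots,b_m)(z)$ defined by $D_{-1}=0$, $D_0=1$, $D_k=b_k z D_{k-1}+D_{k-2}$. For a knot, $m=2n$ and $a_n=|b_1\cdots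 b_m|$. *)

theory Defs
  imports
    "HOL-Computational_Algebra.Polynomial"
    "HOL-Computational_Algebra.Formal_Laurent_Series"
begin

text \<open>
  Oriented link diagrams in Morse position, read from bottom to top as a list of elementary
  pieces. A pair \<open>(i, p)\<close> is the piece \<open>p\<close> with exactly \<open>i\<close> vertical strands to its left.

  \<open>Cup up\<close> creates two adjacent strand ends (a local minimum); the left one is oriented upwards
  iff \<open>up\<close>. \<open>Cap\<close> joins two adjacent strands (a local maximum). \<open>Cross s\<close> crosses two adjacent
  strands; the strand from bottom left to top right is the overstrand iff \<open>s\<close>.
\<close>

datatype piece = Cup bool | Cap | Cross bool

type_synonym diagram = "(nat \<times> piece) list"

fun strands_in :: "piece \<Rightarrow> nat" where
  "strands_in (Cup up) = 0"
| "strands_in Cap = 2"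
| "strands_in (Cross s) = 2"

fun strands_out :: "piece \<Rightarrow> nat" where
  "strands_out (Cup up) = 2"
| "strands_out Cap = 0"
| "strands_out (Cross s) = 2"

text \<open>
  \<open>orient os D\<close> propagates the orientations \<open>os\<close> (\<open>True\<close> = upwards) of the strands entering \<open>D\<close>
  from below, listed from left to right, to those leaving \<open>D\<close> at the top. It is \<open>None\<close> if a piece
  does not fit or a cap joins two strands with incompatible orientations.
\<close>

fun orient_piece :: "nat \<Rightarrow> piece \<Rightarrow> bool list \<Rightarrow> bool list option" where
  "orient_piece i (Cup up) os =
     (if i \<le> length os then Some (take i os @ [up, \<not> up] @ drop i os) else None)"
| "orient_piece i Cap os =
     (if i + 1 < length os \<and> os ! i \<noteq> os ! (i + 1)
      then Some (take i os @ drop (i + 2) os) else None)"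
| "orient_piece i (Cross s) os =
     (if i + 1 < length os
      then Some (take i os @ [os ! (i + 1), os ! i] @ drop (i + 2) os) else None)"

fun orient :: "bool list \<Rightarrow> diagram \<Rightarrow> bool list option" where
  "orient os [] = Some os"
| "orient os ((i, p) # D) = Option.bind (orient_piece i p os) (\<lambda>os'. orient os' D)"

definition link_diagram :: "diagram \<Rightarrow> bool" where
  "link_diagram D \<longleftrightarrow> orient [] D = Some []"

text \<open>
  Local moves generating isotopy of oriented links on diagrams in Morse position: planar isotopies
  (\<open>far\<close>, \<open>zigzag\<close>, \<open>slide\<close>) and the three Reidemeister moves.
\<close>

inductive local_move :: "diagram \<Rightarrow> diagram \<Rightarrow> bool" where
  far: "local_move [(i, p), (i + strands_out p + k, q)] [(i + strands_in p + k, q), (i, p)]"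
| zigzag_right: "local_move [(i, Cup up), (i + 1, Cap)] []"
| zigzag_left: "local_move [(i + 1, Cup up), (i, Cap)] []"
| slide_cap: "local_move [(i, Cross s), (i + 1, Cap)] [(i + 1, Cross (\<not> s)), (i, Cap)]"
| slide_cup: "local_move [(i + 1, Cup up), (i, Cross s)] [(i, Cup up), (i + 1, Cross (\<not> s))]"
| reidemeister1_cap: "local_move [(i, Cross s), (i, Cap)] [(i, Cap)]"
| reidemeister1_cup: "local_move [(i, Cup up), (i, Cross s)] [(i, Cup (\<not> up))]"
| reidemeister2: "local_move [(i, Cross s), (i, Cross (\<not> s))] []"
| reidemeister3: "local_move [(i, Cross s), (i + 1, Cross s), (i, Cross s)]
                             [(i + 1, Cross s), (i, Cross s), (i + 1, Cross s)]"

definition diagram_move :: "diagram \<Rightarrow> diagram \<Rightarrow> bool" where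
  "diagram_move D E \<longleftrightarrow> link_diagram D \<and> link_diagram E \<and>
     (\<exists>U V L R. local_move L R \<and> D = U @ L @ V \<and> E = U @ R @ V)"

definition isotopic :: "diagram \<Rightarrow> diagram \<Rightarrow> bool" where
  "isotopic = equivclp diagram_move"

text \<open>
  Number of components, by tracing the diagram upwards. Two strands carry the same label iff they
  are joined by an arc below the current level (\<open>k\<close> is the next unused label); a cap joining two
  equally labelled strands closes a component, any other cap merges two arcs.
\<close>

fun closed_components :: "nat list \<Rightarrow> nat \<Rightarrow> diagram \<Rightarrow> nat" where
  "closed_components ls k [] = 0"
| "closed_components ls k ((i, Cup up) # D) =
     closed_components (take i ls @ [k, k] @ drop i ls) (Suc k) D"
| "closed_components ls k ((i, Cross s) # D) =
     closed_components (take i ls @ [ls ! (i + 1), ls ! i] @ drop (i + 2) ls) k D"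
| "closed_components ls k ((i, Cap) # D) =
     (let ls' = take i ls @ drop (i + 2) ls; a = ls ! i; b = ls ! (i + 1)
      in if a = b then Suc (closed_components ls' k D)
         else closed_components (map (\<lambda>l. if l = b then a else l) ls') k D)"

definition knot :: "diagram \<Rightarrow> bool" where
  "knot D \<longleftrightarrow> link_diagram D \<and> closed_components [] 0 D = 1"

text \<open>
  The oriented smoothing of a crossing at position \<open>i\<close> whose left and right incoming (bottom)
  strands have the vertical directions \<open>l\<close> and \<open>r\<close>.
\<close>

definition smoothing :: "nat \<Rightarrow> bool \<Rightarrow> bool \<Rightarrow> diagram" where
  "smoothing i l r = (if l = r then [] else [(i, Cap), (i, Cup r)])"

text \<open>
  \<open>conway_polynomial nabla\<close>: the function \<open>nabla\<close> assigns to every oriented link diagram its Conway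
  polynomial in \<open>z = [:0, 1:]\<close>. The crossing \<open>Cross s\<close> is positive iff \<open>s\<close> holds and its strands
  run in the same vertical direction, or \<open>s\<close> fails and they run in opposite directions;
  hence \<open>Cross (l = r)\<close> below is positive and \<open>Cross (l \<noteq> r)\<close> is negative.
\<close>

definition conway_polynomial :: "(diagram \<Rightarrow> int poly) \<Rightarrow> bool" where
  "conway_polynomial nabla \<longleftrightarrow>
     (\<forall>D E. isotopic D E \<longrightarrow> nabla D = nabla E) \<and>
     nabla [(0, Cup True), (0, Cap)] = 1 \<and>
     (\<forall>U V i os l r.
        orient [] U = Some os \<and> i + 1 < length os \<and> l = os ! i \<and> r = os ! (i + 1) \<and>
        link_diagram (U @ [(i, Cross (l = r))] @ V) \<longrightarrow>
        nabla (U @ [(i, Cross (l = r))] @ V) - nabla (U @ [(i, Cross (l \<noteq> r))] @ V)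
          = [:0, 1:] * nabla (U @ smoothing i l r @ V))"

text \<open>
  The Alexander polynomial, determined up to sign by \<open>\<Delta>(t) = \<plusminus>nabla(t\<^sup>1\<^sup>/\<^sup>2 - t\<^sup>-\<^sup>1\<^sup>/\<^sup>2)\<close>. With
  \<open>X = t\<^sup>1\<^sup>/\<^sup>2\<close> this is the identity \<open>\<Delta>(X\<^sup>2) = \<plusminus>nabla(X - X\<^sup>-\<^sup>1)\<close> of Laurent polynomials in \<open>X\<close>.
\<close>

definition alexander_polynomial :: "(diagram \<Rightarrow> int poly) \<Rightarrow> diagram \<Rightarrow> int fls \<Rightarrow> bool" where
  "alexander_polynomial nabla K \<Delta> \<longleftrightarrow>
     (\<exists>\<epsilon> \<in> {1, -1}. fls_compose_power \<Delta> 2 =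
        \<epsilon> * poly (map_poly fls_const (nabla K)) (fls_X - fls_X_inv))"

text \<open>\<open>a\<^sub>0 - a\<^sub>1 (t + t\<^sup>-\<^sup>1) + a\<^sub>2 (t\<^sup>2 + t\<^sup>-\<^sup>2) - \<dots> + (-1)\<^sup>n a\<^sub>n (t\<^sup>n + t\<^sup>-\<^sup>n)\<close>\<close>

definition alternating_laurent :: "nat \<Rightarrow> (nat \<Rightarrow> int) \<Rightarrow> int fls" where
  "alternating_laurent n a =
     fls_const (a 0) +
     (\<Sum>i = 1..n. fls_const ((-1) ^ i * a i) * (fls_X_intpow (int i) + fls_X_intpow (- int i)))"

text \<open>
  The diagram in Conway normal form \<open>C(a\<^sub>1, \<dots>, a\<^sub>m)\<close>, as a four-strand plat. The twist regions lie
  alternately between strands 2, 3 and between strands 1, 2; the sign conventions of the two kinds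
  of region are opposite, so that the diagram is alternating if all \<open>a\<^sub>i\<close> have the same sign. The
  upper closure depends on the parity of \<open>m\<close>. The four strands are oriented up, down, up, down; if
  all \<open>a\<^sub>i\<close> are even, this is preserved by each twist region, whose two strands are antiparallel.
\<close>

fun twist_regions :: "nat \<Rightarrow> int list \<Rightarrow> diagram" where
  "twist_regions i [] = []"
| "twist_regions i (a # as) =
     replicate (nat \<bar>a\<bar>) (i, Cross (if i = 1 then a < 0 else a > 0)) @ twist_regions (1 - i) as"

definition conway_normal_form :: "int list \<Rightarrow> diagram" where
  "conway_normal_form as =
     [(0, Cup True), (2, Cup True)] @ twist_regions 1 as @
     (if even (length as) then [(1, Cap), (0, Cap)] else [(0, Cap), (0, Cap)])"

text \<open>\<open>C(2b\<^sub>1, -2b\<^sub>2, \<dots>, (-1)\<^sup>m\<^sup>-\<^sup>1 2b\<^sub>m)\<close>\<close>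

definition two_bridge_diagram :: "int list \<Rightarrow> diagram" where
  "two_bridge_diagram bs =
     conway_normal_form (map (\<lambda>k. (-1) ^ k * (2 * bs ! k)) [0..<length bs])"

definition two_bridge_knot :: "diagram \<Rightarrow> bool" where
  "two_bridge_knot K \<longleftrightarrow>
     (\<exists>bs. 0 \<notin> set bs \<and> knot (two_bridge_diagram bs) \<and> isotopic (two_bridge_diagram bs) K)"

end

theory Submission
  imports Defs
begin

text \<open>
  Let \<open>b\<^sub>1, \<dots>, b\<^sub>m\<close> be the twist numbers of a two-bridge diagram. The skein relation at a crossing of
  the topmost twist region removes a full twist when the crossing is changed. When it is smoothed,
  the rest of the region becomes a turn-back full of kinks, and one region fewer remains. Once all
  full twists of the region are gone, the closing arcs undo the region below it as well, and two
  regions fewer remain. Hence the Conway polynomial satisfies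
  \<open>D\<^sub>m = b\<^sub>m z D\<^sub>m\<^sub>-\<^sub>1 + D\<^sub>m\<^sub>-\<^sub>2\<close>; the boundary value \<open>D\<^sub>-\<^sub>1 = 0\<close> is the Conway polynomial of the unlink with
  two components (\<open>conway_polynomial_twisted_strands\<close>).
  
  Put \<open>z = X - X\<^sup>-\<^sup>1\<close> with \<open>X\<^sup>2 = t\<close>, and let \<open>c\<^sub>j\<close> be the coefficient of \<open>z\<^sup>j\<close> in \<open>D\<^sub>m\<close>. Comparing top
  degrees gives \<open>m = 2n\<close> and \<open>a\<^sub>n = B\<close>, where \<open>B = |b\<^sub>1 \<dots> b\<^sub>m|\<close>, and the binomial theorem gives
  \<open>a\<^sub>n\<^sub>-\<^sub>2 = |c\<^sub>m\<^sub>-\<^sub>4 - (m - 2) c\<^sub>m\<^sub>-\<^sub>2 + (m choose 2) c\<^sub>m|\<close>. The recursion and the inequality \<open>x + y \<le> x y + 1\<close>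
  for \<open>x, y \<ge> 1\<close> yield
  \<open>|c\<^sub>m\<^sub>-\<^sub>2| \<le> (m - 2) B + 1\<close> and \<open>|c\<^sub>m\<^sub>-\<^sub>4| \<le> (m - 3 choose 2) B + m - 3\<close>
  (\<open>abs_second_coeff_continuant_le\<close>, \<open>abs_third_coeff_continuant_le\<close>). By the triangle inequality
  \<open>a\<^sub>n\<^sub>-\<^sub>2 \<le> (8n\<^sup>2 - 16n + 10) B + 4n - 5\<close>, which falls short of the asserted bound by \<open>(n - 2) (B - 2)\<close>.
  This is nonnegative, because \<open>a\<^sub>n \<noteq> 1\<close> means \<open>B \<ge> 2\<close>.
  
  For the twist numbers \<open>2, -1, 1, -1, \<dots>\<close> the bounds on \<open>|c\<^sub>m\<^sub>-\<^sub>2|\<close> and \<open>|c\<^sub>m\<^sub>-\<^sub>4|\<close> are attained and the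
  alternating signs make the three terms of \<open>a\<^sub>n\<^sub>-\<^sub>2\<close> reinforce each other; since \<open>B = 2\<close>, equality holds.
  The same alternation makes all \<open>a\<^sub>i\<close> positive (\<open>third_coefficient_sharp\<close>).
\<close>

section \<open>Isotopy of parts of oriented diagrams\<close>

lemma orient_append:
  "orient os (U @ V) = Option.bind (orient os U) (\<lambda>os'. orient os' V)"
  by (induction os U rule: orient.induct) (auto split: bind_splits)

text \<open>
  The strands entering from below carry the orientations \<open>os\<close>, because a Morse piece fits only
  certain orientations. The quantification over \<open>U\<close> and \<open>V\<close> makes it possible to reason about a small
  part of a diagram and to insert the result into every diagram that contains it.
\<close>

definition tangle_isotopic :: "bool list \<Rightarrow> diagram \<Rightarrow> diagram \<Rightarrow> bool" where
  "tangle_isotopic os L R \<longleftrightarrow> orient os L = orient os R \<and>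
     (\<forall>U V. orient [] U = Some os \<longrightarrow> link_diagram (U @ L @ V) \<longrightarrow>
            isotopic (U @ L @ V) (U @ R @ V))"

lemma tangle_isotopic_refl: "tangle_isotopic os L L"
  by (simp add: tangle_isotopic_def isotopic_def)

lemma tangle_isotopic_sym: "tangle_isotopic os L R \<Longrightarrow> tangle_isotopic os R L"
  by (auto simp: tangle_isotopic_def isotopic_def link_diagram_def orient_append
           intro: equivclp_sym)

lemma tangle_isotopic_trans [trans]:
  "tangle_isotopic os L M \<Longrightarrow> tangle_isotopic os M R \<Longrightarrow> tangle_isotopic os L R"
  unfolding tangle_isotopic_def isotopic_def link_diagram_def orient_append
  by (auto; meson equivclp_trans)

lemma tangle_isotopic_local_move:
  assumes "local_move L R" "orient os L = orient os R"
  shows "tangle_isotopic os L R"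
proof -
  have "diagram_move (U @ L @ V) (U @ R @ V)" if "orient [] U = Some os" "link_diagram (U @ L @ V)" for U V
  proof -
    have "link_diagram (U @ R @ V)"
      using that assms(2) by (simp add: link_diagram_def orient_append)
    thus ?thesis using that assms(1) unfolding diagram_move_def by blast
  qed
  thus ?thesis
    using assms(2) by (auto simp: tangle_isotopic_def isotopic_def intro: r_into_equivclp)
qed

lemma tangle_isotopic_context:
  assumes "tangle_isotopic os' L R" "orient os A = Some os'"
  shows "tangle_isotopic os (A @ L @ B) (A @ R @ B)"
proof -
  have "isotopic (U @ (A @ L @ B) @ V) (U @ (A @ R @ B) @ V)"
    if "orient [] U = Some os" "link_diagram (U @ (A @ L @ B) @ V)" for U V
  proof -
    have "orient [] (U @ A) = Some os'"
      using that assms(2) by (simp add: orient_append)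
    moreover have "link_diagram ((U @ A) @ L @ (B @ V))" using that by simp
    ultimately have "isotopic ((U @ A) @ L @ (B @ V)) ((U @ A) @ R @ (B @ V))"
      using assms(1) unfolding tangle_isotopic_def by blast
    thus ?thesis by simp
  qed
  thus ?thesis using assms by (auto simp: tangle_isotopic_def orient_append)
qed

lemma conway_polynomial_tangle_isotopic:
  assumes "conway_polynomial nabla" "tangle_isotopic os L R"
    and "orient [] U = Some os" "link_diagram (U @ L @ V)"
  shows "nabla (U @ L @ V) = nabla (U @ R @ V)"
  using assms unfolding tangle_isotopic_def conway_polynomial_def by blast

lemma conway_polynomial_skein:
  assumes "conway_polynomial nabla" "orient [] U = Some os" "i + 1 < length os"
    and "l = os ! i" "r = os ! (i + 1)" "link_diagram (U @ [(i, Cross (l = r))] @ V)"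
  shows "nabla (U @ [(i, Cross (l = r))] @ V) - nabla (U @ [(i, Cross (l \<noteq> r))] @ V) =
         [:0, 1:] * nabla (U @ smoothing i l r @ V)"
  using assms unfolding conway_polynomial_def by blast

section \<open>The unlink with two components\<close>

text \<open>
  The unlink arises by smoothing the only crossing of an unknot diagram. Both signs of that crossing
  give the unknot, so the skein relation reads \<open>1 - 1 = z nabla(unlink)\<close>. The crossing joins two
  parallel strands, which makes the two circles run in opposite directions; the kinks at the end of
  the proof reverse one of them.
\<close>

lemma conway_polynomial_two_component_unlink:
  assumes "conway_polynomial nabla"
  shows "nabla [(0, Cup True), (2, Cup True), (0, Cap), (0, Cap)] = 0"
proof -
  let ?caps = "[(0, Cap), (0, Cap)] :: diagram"
  let ?cups = "[(0, Cup True), (2, Cup False)] :: diagram"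
  note move = tangle_isotopic_local_move
  have far: "tangle_isotopic [True, False, l, r] [(2, Cross s), (0, Cap)] [(0, Cap), (0, Cross s)]"
    for l r s
  proof -
    have "local_move [(0, Cap), (0 + strands_out Cap + 0, Cross s)]
                     [(0 + strands_in Cap + 0, Cross s), (0, Cap)]"
      by (rule local_move.far)
    thus ?thesis
      by (intro tangle_isotopic_sym[OF move]) (auto simp: numeral_2_eq_2)
  qed
  have R1: "tangle_isotopic [l, \<not> l] [(0, Cross s), (0, Cap)] [(0, Cap)]" for l s
    by (rule move[OF reidemeister1_cap]) auto
  \<comment> \<open>A crossing right of the first closed arc slides up to the second one, where it is a kink.\<close>
  have untwist: "tangle_isotopic [True, False, l, \<not> l] ([(2, Cross s)] @ ?caps) ?caps" for l s
    using tangle_isotopic_context[OF far[of l "\<not> l" s], of "[True, False, l, \<not> l]" "[]" "[(0, Cap)]"]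
      tangle_isotopic_context[OF R1[of l s], of "[True, False, l, \<not> l]" "[(0, Cap)]" "[]"]
    by (auto intro: tangle_isotopic_trans)
  have unknot: "nabla (?cups @ [(1, Cross s)] @ ?caps) = 1" for s
  proof -
    have slide: "tangle_isotopic [True, False] [(2, Cup False), (1, Cross s)]
                                 [(1, Cup False), (2, Cross (\<not> s))]"
      using move[OF slide_cup[of 1 False s], of "[True, False]"] by (simp add: numeral_2_eq_2)
    have zigzag: "tangle_isotopic [True, False] [(1, Cup False), (0, Cap)] []"
      using move[OF zigzag_left[of 0 False], of "[True, False]"] by (simp add: numeral_2_eq_2)
    have "tangle_isotopic [True, False] ([(2, Cup False), (1, Cross s)] @ ?caps)
                          ([(1, Cup False), (2, Cross (\<not> s))] @ ?caps)"
      using tangle_isotopic_context[OF slide, of "[True, False]" "[]" ?caps] by simp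
    also have "tangle_isotopic [True, False] \<dots> ([(1, Cup False)] @ ?caps)"
      using tangle_isotopic_context[OF untwist[of True "\<not> s"], of "[True, False]" "[(1, Cup False)]" "[]"]
      by (simp add: numeral_2_eq_2)
    also have "tangle_isotopic [True, False] \<dots> [(0, Cap)]"
      using tangle_isotopic_context[OF zigzag, of "[True, False]" "[]" "[(0, Cap)]"] by simp
    finally have "nabla ([(0, Cup True)] @ ([(2, Cup False), (1, Cross s)] @ ?caps) @ []) =
        nabla ([(0, Cup True)] @ [(0, Cap)] @ [])"
      by (rule conway_polynomial_tangle_isotopic[OF assms])
         (auto simp: link_diagram_def numeral_2_eq_2)
    thus ?thesis using assms by (simp add: conway_polynomial_def)
  qed
  have "orient [] ?cups = Some [True, False, False, True]" by simp
  from conway_polynomial_skein[OF assms this, of 1 False False ?caps]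
  have "nabla (?cups @ [(1, Cross True)] @ ?caps) - nabla (?cups @ [(1, Cross False)] @ ?caps)
          = [:0, 1:] * nabla (?cups @ smoothing 1 False False @ ?caps)"
    by (simp add: link_diagram_def numeral_2_eq_2)
  hence split: "nabla (?cups @ ?caps) = 0"
    using unknot[of True] unknot[of False] by (simp add: smoothing_def)
  \<comment> \<open>A kink at the minimum reverses the right circle; the same crossing is a removable kink at
    its maximum.\<close>
  have "tangle_isotopic [True, False] ([(2, Cup False)] @ ?caps) ([(2, Cup True), (2, Cross True)] @ ?caps)"
    using tangle_isotopic_context[OF tangle_isotopic_sym[OF move[OF reidemeister1_cup[of 2 True True], 
       of "[True, False]"]], of "[True, False]" "[]" ?caps]
    by (simp add: numeral_2_eq_2)
  also have "tangle_isotopic [True, False] \<dots> ([(2, Cup True)] @ ?caps)"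
    using tangle_isotopic_context[OF untwist[of True True], of "[True, False]" "[(2, Cup True)]" "[]"]
    by simp
  finally have "nabla ([(0, Cup True)] @ ([(2, Cup False)] @ ?caps) @ []) =
        nabla ([(0, Cup True)] @ ([(2, Cup True)] @ ?caps) @ [])"
    by (rule conway_polynomial_tangle_isotopic[OF assms]) (auto simp: link_diagram_def)
  thus ?thesis using split by simp
qed

section \<open>The Conway polynomial of a two-bridge diagram\<close>

lemma untwist_below_cap:
  assumes "i + 1 < length os" "os ! i \<noteq> os ! (i + 1)"
  shows "tangle_isotopic os (replicate N (i, Cross s) @ [(i, Cap)]) [(i, Cap)]"
  using assms
proof (induction N arbitrary: os)
  case 0
  show ?case by (simp add: tangle_isotopic_refl)
next
  case (Suc N)
  define os' where "os' = take i os @ [os ! (i + 1), os ! i] @ drop (i + 2) os"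
  have os': "i + 1 < length os'" "os' ! i \<noteq> os' ! (i + 1)" "orient os [(i, Cross s)] = Some os'"
    using Suc.prems by (auto simp: os'_def nth_append)
  have "tangle_isotopic os ([(i, Cross s)] @ (replicate N (i, Cross s) @ [(i, Cap)]) @ [])
          ([(i, Cross s)] @ [(i, Cap)] @ [])"
    by (rule tangle_isotopic_context[OF Suc.IH]) (use os' in auto)
  also have "tangle_isotopic os \<dots> [(i, Cap)]"
    using tangle_isotopic_local_move[OF reidemeister1_cap[of i s], of os] Suc.prems
    by (auto simp: nth_append)
  finally show ?case by simp
qed

definition twist_position :: "nat \<Rightarrow> nat" where
  "twist_position k = (if even k then 1 else 0)"

definition upper_closure :: "nat \<Rightarrow> diagram" where
  "upper_closure k = (if even k then [(1, Cap), (0, Cap)] else [(0, Cap), (0, Cap)])"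

text \<open>
  The four strands of a two-bridge diagram with its first \<open>k\<close> twist regions. In both kinds
  of region \<open>b k > 0\<close> means positive crossings: the sign \<open>(-1)^k\<close> of the Conway normal form
  compensates for the opposite conventions of the two kinds of region.
\<close>

primrec twisted_strands :: "(nat \<Rightarrow> int) \<Rightarrow> nat \<Rightarrow> diagram" where
  "twisted_strands b 0 = [(0, Cup True), (2, Cup True)]"
| "twisted_strands b (Suc k) =
     twisted_strands b k @ replicate (2 * nat \<bar>b k\<bar>) (twist_position k, Cross (b k < 0))"

lemma orient_twist_region:
  "orient [True, False, True, False] (replicate N (twist_position k, Cross s)) =
     Some (if even N then [True, False, True, False]
           else if even k then [True, True, False, False] else [False, True, True, False])"
proof (induction N)
  case (Suc N)
  let ?x = "(twist_position k, Cross s)"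
  have "orient [True, False, True, False] [?x] =
          Some (if even k then [True, True, False, False] else [False, True, True, False])"
    "even k \<Longrightarrow> orient [True, True, False, False] [?x] = Some [True, False, True, False]"
    "odd k \<Longrightarrow> orient [False, True, True, False] [?x] = Some [True, False, True, False]"
    by (simp_all add: twist_position_def)
  moreover have "replicate (Suc N) ?x = replicate N ?x @ [?x]"
    by (simp add: replicate_append_same)
  ultimately show ?case using Suc
    by (simp add: orient_append del: replicate_Suc orient.simps)
qed auto

lemma orient_twisted_strands: "orient [] (twisted_strands b k) = Some [True, False, True, False]"
  by (induction k) (auto simp: orient_append orient_twist_region)

lemma orient_upper_closure: "orient [True, False, True, False] (upper_closure k) = Some []"
  by (simp add: upper_closure_def numeral_2_eq_2)

lemma twist_regions_append:
  "i \<le> 1 \<Longrightarrow> twist_regions i (xs @ ys) =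
     twist_regions i xs @ twist_regions (if even (length xs) then i else 1 - i) ys"
  by (induction i xs rule: twist_regions.induct) auto

lemma two_bridge_diagram_conv_twisted_strands:
  "two_bridge_diagram bs = twisted_strands ((!) bs) (length bs) @ upper_closure (length bs)"
proof -
  have "[(0, Cup True), (2, Cup True)] @
      twist_regions 1 (map (\<lambda>k. (-1) ^ k * (2 * b k)) [0..<m]) = twisted_strands b m" for b m
  proof (induction m)
    case (Suc m)
    thus ?case by (auto simp: twist_regions_append twist_position_def nat_mult_distrib abs_mult)
  qed auto
  from this[of "(!) bs" "length bs"] show ?thesis
    by (simp add: two_bridge_diagram_def conway_normal_form_def upper_closure_def)
qed

text \<open>
  If the region of index \<open>Suc k\<close> is empty, the upper closure caps off the two strands of the
  region of index \<open>k\<close>, whose crossings are then removed one after another by the first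
  Reidemeister move.
\<close>

lemma conway_polynomial_untwisted_region:
  assumes "conway_polynomial nabla"
  shows "nabla (twisted_strands b (Suc k) @ upper_closure k) =
         nabla (twisted_strands b k @ upper_closure k)"
proof -
  let ?p = "twist_position k"
  obtain C where C: "upper_closure k = [(?p, Cap)] @ C"
    by (auto simp: upper_closure_def twist_position_def)
  have "nabla (twisted_strands b k @
          (replicate (2 * nat \<bar>b k\<bar>) (?p, Cross (b k < 0)) @ [(?p, Cap)]) @ C) =
        nabla (twisted_strands b k @ [(?p, Cap)] @ C)"
  proof (rule conway_polynomial_tangle_isotopic[OF assms untwist_below_cap orient_twisted_strands])
    have "orient [] (twisted_strands b (Suc k) @ upper_closure k) = Some []"
      by (simp add: orient_append orient_twisted_strands orient_upper_closure
               del: twisted_strands.simps)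
    thus "link_diagram (twisted_strands b k @
        (replicate (2 * nat \<bar>b k\<bar>) (?p, Cross (b k < 0)) @ [(?p, Cap)]) @ C)"
      by (simp add: link_diagram_def C)
  qed (auto simp: twist_position_def)
  thus ?thesis by (simp add: C)
qed

text \<open>
  This is the skein relation at the topmost crossing of the last region. The two strands of a region
  are antiparallel, so \<open>s\<close> marks a negative crossing and the smoothing is a turn-back. The changed
  crossing cancels against the one below it; the turn-back absorbs the crossings below it and its
  upper half straightens together with one arc of the closure, which leaves the closure for one
  region fewer.
\<close>

lemma conway_polynomial_add_full_twist:
  assumes "conway_polynomial nabla"
  defines "f \<equiv> \<lambda>b k s N. nabla (twisted_strands b k @ replicate (2 * N) (twist_position k, Cross s)
                                @ upper_closure (Suc k))"
  shows "f b k s (Suc N) = f b k s N +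
           (if s then -1 else 1) * [:0, 1:] * nabla (twisted_strands b k @ upper_closure k)"
proof -
  define p where "p = twist_position k"
  define U where "U = twisted_strands b k @ replicate (2 * N + 1) (p, Cross s)"
  define os where "os = (if even k then [True, True, False, False] else [False, True, True, False])"
  let ?C = "upper_closure (Suc k)" and ?base = "[True, False, True, False]"
  have U: "orient [] U = Some os"
    by (simp add: U_def os_def p_def orient_append orient_twisted_strands orient_twist_region
             del: replicate_Suc)
  have os: "p + 1 < length os" "os ! p \<noteq> os ! (p + 1)"
    by (auto simp: os_def p_def twist_position_def)
  \<comment> \<open>An odd number of crossings of the region has exchanged its two strands; one more restores
    their order.\<close>
  have flip: "orient os [(p, Cross s')] = Some ?base" for s'
    by (simp add: os_def p_def twist_position_def numeral_2_eq_2)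
  have link: "link_diagram (U @ [(p, Cross s')] @ ?C)" for s'
    unfolding link_diagram_def orient_append U using orient_upper_closure[of "Suc k"] flip[of s']
    by (simp del: orient.simps)
  have skein: "nabla (U @ [(p, Cross s)] @ ?C) - nabla (U @ [(p, Cross (\<not> s))] @ ?C) =
      (if s then -1 else 1) * [:0, 1:] * nabla (U @ [(p, Cap), (p, Cup (os ! (p + 1)))] @ ?C)"
    using conway_polynomial_skein[OF assms(1) U os(1) refl refl link] os(2)
    by (cases s) (auto simp: smoothing_def algebra_simps)
  have split_twist: "replicate (2 * M + 1) x = replicate (2 * M) x @ [x]" for M and x :: "nat \<times> piece"
    by (simp add: replicate_append_same)
  have more: "nabla (U @ [(p, Cross s)] @ ?C) = f b k s (Suc N)"
  proof -
    have "replicate (2 * Suc N) (p, Cross s) = replicate (2 * N + 1) (p, Cross s) @ [(p, Cross s)]"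
      by (simp add: replicate_append_same)
    thus ?thesis unfolding f_def U_def p_def by (simp only: append_assoc)
  qed
  have fewer: "nabla (U @ [(p, Cross (\<not> s))] @ ?C) = f b k s N"
  proof -
    have R2: "tangle_isotopic ?base [(p, Cross s), (p, Cross (\<not> s))] []"
      by (rule tangle_isotopic_local_move[OF reidemeister2])
         (auto simp: p_def twist_position_def numeral_2_eq_2)
    let ?W = "twisted_strands b k @ replicate (2 * N) (p, Cross s)"
    have W: "orient [] ?W = Some ?base"
      by (simp add: orient_append orient_twisted_strands orient_twist_region p_def)
    have "link_diagram (?W @ [(p, Cross s), (p, Cross (\<not> s))] @ ?C)"
      using link[of "\<not> s"] unfolding U_def split_twist
      by (simp only: append_assoc append_Cons append_Nil)
    hence "nabla (?W @ [(p, Cross s), (p, Cross (\<not> s))] @ ?C) = nabla (?W @ [] @ ?C)"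
      by (rule conway_polynomial_tangle_isotopic[OF assms(1) R2 W])
    thus ?thesis unfolding U_def split_twist by (simp add: f_def p_def)
  qed
  have smoothed: "nabla (U @ [(p, Cap), (p, Cup (os ! (p + 1)))] @ ?C) =
      nabla (twisted_strands b k @ upper_closure k)"
  proof -
    let ?r = "os ! (p + 1)"
    have "tangle_isotopic ?base (replicate (2 * N + 1) (p, Cross s) @ [(p, Cap)]) [(p, Cap)]"
      by (rule untwist_below_cap) (auto simp: p_def twist_position_def)
    from tangle_isotopic_context[OF this, of ?base "[]" "[(p, Cup ?r)] @ ?C"]
    have "tangle_isotopic ?base (replicate (2 * N + 1) (p, Cross s) @ [(p, Cap), (p, Cup ?r)] @ ?C)
            ([(p, Cap), (p, Cup ?r)] @ ?C)"
      by simp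
    also have "tangle_isotopic ?base \<dots> (upper_closure k)"
    proof (cases "even k")
      case True
      have "tangle_isotopic [True, False] [(1, Cup False), (0, Cap)] []"
        using tangle_isotopic_local_move[OF zigzag_left[of 0 False], of "[True, False]"]
        by (simp add: numeral_2_eq_2)
      from tangle_isotopic_context[OF this, of ?base "[(1, Cap)]" "[(0, Cap)]"] True
      show ?thesis
        by (simp add: p_def twist_position_def upper_closure_def os_def)
    next
      case False
      have "tangle_isotopic [True, False] [(0, Cup True), (1, Cap)] []"
        using tangle_isotopic_local_move[OF zigzag_right[of 0 True], of "[True, False]"]
        by (simp add: numeral_2_eq_2)
      from tangle_isotopic_context[OF this, of ?base "[(0, Cap)]" "[(0, Cap)]"] False
      show ?thesis
        by (simp add: p_def twist_position_def upper_closure_def os_def)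
    qed
    finally have iso: "tangle_isotopic ?base
        (replicate (2 * N + 1) (p, Cross s) @ [(p, Cap), (p, Cup ?r)] @ ?C) (upper_closure k)" .
    hence "orient ?base (replicate (2 * N + 1) (p, Cross s) @ [(p, Cap), (p, Cup ?r)] @ ?C) = Some []"
      unfolding tangle_isotopic_def using orient_upper_closure by simp
    hence "link_diagram (twisted_strands b k @
        (replicate (2 * N + 1) (p, Cross s) @ [(p, Cap), (p, Cup ?r)] @ ?C) @ [])"
      by (simp add: link_diagram_def orient_append orient_twisted_strands del: orient.simps)
    from conway_polynomial_tangle_isotopic[OF assms(1) iso orient_twisted_strands this]
    show ?thesis by (simp add: U_def)
  qed
  show ?thesis using skein unfolding more fewer smoothed by (simp add: algebra_simps)
qed

fun continuant :: "(nat \<Rightarrow> int) \<Rightarrow> nat \<Rightarrow> int poly" where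
  "continuant b 0 = 1"
| "continuant b (Suc 0) = [:0, b 0:]"
| "continuant b (Suc (Suc k)) = [:0, b (Suc k):] * continuant b (Suc k) + continuant b k"

text \<open>
  Adding the full twists of the last region one at a time gives the recursion of the continuant. With
  one region, the diagram left after removing all its crossings is the unlink, not a diagram with
  fewer regions; its vanishing Conway polynomial is the missing term \<open>D\<^sub>-\<^sub>1\<close>.
\<close>

theorem conway_polynomial_twisted_strands:
  assumes "conway_polynomial nabla"
  shows "nabla (twisted_strands b k @ upper_closure k) = continuant b k"
proof -
  have twists: "nabla (twisted_strands b k @ replicate (2 * N) (twist_position k, Cross s)
            @ upper_closure (Suc k)) =
          nabla (twisted_strands b k @ upper_closure (Suc k)) +
          [:0, if s then - int N else int N:] * nabla (twisted_strands b k @ upper_closure k)"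
    for N s k b
  proof (induction N)
    case (Suc N)
    show ?case unfolding conway_polynomial_add_full_twist[OF assms] Suc.IH
      by (cases s) (simp_all add: algebra_simps smult_diff_left smult_add_left)
  qed simp
  have region: "nabla (twisted_strands b (Suc k) @ upper_closure (Suc k)) =
          nabla (twisted_strands b k @ upper_closure (Suc k)) +
          [:0, b k:] * nabla (twisted_strands b k @ upper_closure k)" for k b
    using twists[of b k "nat \<bar>b k\<bar>" "b k < 0"] by (auto simp: abs_if split: if_splits)
  have start: "nabla (twisted_strands b 0 @ upper_closure 0) = 1" for b
  proof -
    have "tangle_isotopic [True, False] [(2, Cup True), (1, Cap)] []"
      using tangle_isotopic_local_move[OF zigzag_left[of 1 True], of "[True, False]"]
      by (simp add: numeral_2_eq_2)
    hence "nabla ([(0, Cup True)] @ [(2, Cup True), (1, Cap)] @ [(0, Cap)]) =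
           nabla ([(0, Cup True)] @ [] @ [(0, Cap)])"
      by (rule conway_polynomial_tangle_isotopic[OF assms]) (auto simp: link_diagram_def numeral_2_eq_2)
    thus ?thesis using assms by (simp add: upper_closure_def conway_polynomial_def)
  qed
  show ?thesis
  proof (induction b k rule: continuant.induct)
    case (1 b)
    show ?case using start by simp
  next
    case (2 b)
    have "twisted_strands b 0 @ upper_closure 1 = [(0, Cup True), (2, Cup True), (0, Cap), (0, Cap)]"
      by (simp add: upper_closure_def)
    thus ?case using region[of b 0] conway_polynomial_two_component_unlink[OF assms] start[of b]
      by (simp del: twisted_strands.simps)
  next
    case (3 b k)
    have "upper_closure (Suc (Suc k)) = upper_closure k" by (simp add: upper_closure_def)
    thus ?case
      using region[of b "Suc k"] conway_polynomial_untwisted_region[OF assms, of b k] 3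
      by (simp del: twisted_strands.simps)
  qed
qed

lemma conway_polynomial_two_bridge:
  assumes "conway_polynomial nabla" "isotopic (two_bridge_diagram bs) K"
  shows "nabla K = continuant ((!) bs) (length bs)"
proof -
  have "nabla K = nabla (two_bridge_diagram bs)"
    using assms unfolding conway_polynomial_def by metis
  thus ?thesis
    by (simp add: two_bridge_diagram_conv_twisted_strands conway_polynomial_twisted_strands[OF assms(1)])
qed

section \<open>Coefficients of continuants\<close>

unbundle fps_syntax

lemma coeff_continuant_Suc_Suc:
  "coeff (continuant b (Suc (Suc k))) (Suc j) =
     b (Suc k) * coeff (continuant b (Suc k)) j + coeff (continuant b k) (Suc j)"
  "coeff (continuant b (Suc (Suc k))) 0 = coeff (continuant b k) 0"
  by simp_all

declare continuant.simps(3) [simp del]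

lemma degree_continuant_le: "degree (continuant b k) \<le> k"
proof (induction b k rule: continuant.induct)
  case (3 b k)
  have "degree ([:0, b (Suc k):] * continuant b (Suc k)) \<le> Suc (Suc k)"
    using degree_mult_le[of "[:0, b (Suc k):]" "continuant b (Suc k)"] 3
    by (auto split: if_splits)
  thus ?case using 3 by (auto simp: continuant.simps(3) intro: degree_add_le)
qed auto

lemma coeff_continuant_top: "coeff (continuant b k) k = (\<Prod>i<k. b i)"
proof (induction b k rule: continuant.induct)
  case (3 b k)
  have "coeff (continuant b k) (Suc (Suc k)) = 0"
    using degree_continuant_le[of b k] by (intro coeff_eq_0) auto
  thus ?case using 3 by (simp add: coeff_continuant_Suc_Suc)
qed auto

lemma continuant_cong:
  "(\<And>i. i < k \<Longrightarrow> b i = c i) \<Longrightarrow> continuant b k = continuant c k"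
proof (induction b k rule: continuant.induct)
  case (3 b k)
  thus ?case by (simp add: continuant.simps(3))
qed auto

lemma coeff_continuant_odd: "odd (k + j) \<Longrightarrow> coeff (continuant b k) j = 0"
proof (induction b k arbitrary: j rule: continuant.induct)
  case (1 b)
  thus ?case by (cases j) auto
next
  case (2 b)
  thus ?case by (cases j) (auto simp: coeff_pCons split: nat.splits)
next
  case (3 b k)
  thus ?case by (cases j) (auto simp: coeff_continuant_Suc_Suc)
qed

text \<open>
  The coefficient is the sum of the products of the \<open>b\<^sub>i\<close> with one pair of neighbours omitted. In the
  induction, let \<open>x\<close> and \<open>y\<close> be the absolute values of the last two factors and \<open>B\<close> that of the product
  of the others. The induction step comes down to \<open>B + y \<le> B x y + 1\<close>, which holds since \<open>B \<le> B x\<close> and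
  \<open>0 \<le> (B x - 1) (y - 1)\<close>. The bound is attained when all \<open>b\<^sub>i\<close> are \<open>1\<close>.
\<close>

lemma abs_second_coeff_continuant_le:
  assumes "\<And>i. i < m + 2 \<Longrightarrow> b i \<noteq> 0"
  shows "\<bar>coeff (continuant b (m + 2)) m\<bar> \<le> int m * \<bar>\<Prod>i<m + 2. b i\<bar> + 1"
  using assms
proof (induction m)
  case 0
  show ?case by (simp add: numeral_2_eq_2 coeff_continuant_Suc_Suc)
next
  case (Suc m)
  define B where "B = \<bar>\<Prod>i<m + 1. b i\<bar>"
  define x where "x = \<bar>b (m + 1)\<bar>"
  define y where "y = \<bar>b (m + 2)\<bar>"
  have pos: "x \<ge> 1" "y \<ge> 1" using Suc.prems[of "m + 1"] Suc.prems[of "m + 2"] by (auto simp: x_def y_def)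
  have "B \<noteq> 0" using Suc.prems by (auto simp: B_def)
  moreover have "B \<ge> 0" by (simp add: B_def)
  ultimately have "B \<ge> 1" by linarith
  have "coeff (continuant b (Suc m + 2)) (Suc m) =
          b (m + 2) * coeff (continuant b (m + 2)) m + (\<Prod>i<m + 1. b i)"
    using coeff_continuant_Suc_Suc(1)[of b "Suc m" m] coeff_continuant_top[of b "Suc m"]
    by (simp add: numeral_2_eq_2)
  hence "\<bar>coeff (continuant b (Suc m + 2)) (Suc m)\<bar> \<le> y * \<bar>coeff (continuant b (m + 2)) m\<bar> + B"
    by (simp add: B_def y_def abs_mult[symmetric])
  also have "\<dots> \<le> y * (int m * (B * x) + 1) + B"
    using Suc.IH Suc.prems pos
    by (intro add_right_mono mult_left_mono) (auto simp: B_def x_def abs_mult)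
  also have "\<dots> \<le> int (Suc m) * (B * x * y) + 1"
  proof -
    have "B \<le> B * x" using \<open>B \<ge> 1\<close> pos by simp
    hence "0 \<le> (B * x - 1) * (y - 1) + (B * x - B)" using pos \<open>B \<ge> 1\<close> by auto
    thus ?thesis by (simp add: algebra_simps)
  qed
  also have "B * x * y = \<bar>\<Prod>i<Suc m + 2. b i\<bar>"
    by (simp add: B_def x_def y_def abs_mult)
  finally show ?case .
qed

text \<open>
  The next coefficient omits two disjoint pairs of neighbours, and the recursion reduces it to itself
  and to the coefficient with one omitted pair. Both sides are doubled because \<open>B\<close> really occurs with
  the factor \<open>m + 1 choose 2\<close>.
\<close>

lemma abs_third_coeff_continuant_le:
  assumes "\<And>i. i < m + 4 \<Longrightarrow> b i \<noteq> 0"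
  shows "2 * \<bar>coeff (continuant b (m + 4)) m\<bar> \<le>
           int m * (int m + 1) * \<bar>\<Prod>i<m + 4. b i\<bar> + 2 * (int m + 1)"
  using assms
proof (induction m)
  case 0
  show ?case by (simp add: eval_nat_numeral coeff_continuant_Suc_Suc)
next
  case (Suc m)
  define B where "B = \<bar>\<Prod>i<m + 3. b i\<bar>"
  define x where "x = \<bar>b (m + 3)\<bar>"
  define y where "y = \<bar>b (m + 4)\<bar>"
  have pos: "x \<ge> 1" "y \<ge> 1" using Suc.prems[of "m + 3"] Suc.prems[of "m + 4"] by (auto simp: x_def y_def)
  have "B \<noteq> 0" using Suc.prems by (auto simp: B_def)
  moreover have "B \<ge> 0" by (simp add: B_def)
  ultimately have "B \<ge> 1" by linarith
  have "coeff (continuant b (Suc m + 4)) (Suc m) =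
          b (m + 4) * coeff (continuant b (m + 4)) m + coeff (continuant b (Suc m + 2)) (Suc m)"
    using coeff_continuant_Suc_Suc(1)[of b "m + 3" m]
    by (simp add: eval_nat_numeral)
  moreover have "2 * \<bar>u * v + w\<bar> \<le> \<bar>u\<bar> * (2 * \<bar>v\<bar>) + 2 * \<bar>w\<bar>" for u v w :: int
  proof -
    have "\<bar>u * v + w\<bar> \<le> \<bar>u\<bar> * \<bar>v\<bar> + \<bar>w\<bar>"
      using abs_triangle_ineq[of "u * v" w] by (simp add: abs_mult)
    thus ?thesis by simp
  qed
  ultimately have "2 * \<bar>coeff (continuant b (Suc m + 4)) (Suc m)\<bar> \<le>
      y * (2 * \<bar>coeff (continuant b (m + 4)) m\<bar>) + 2 * \<bar>coeff (continuant b (Suc m + 2)) (Suc m)\<bar>"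
    by (simp only: y_def)
  also have "\<dots> \<le> y * (int m * (int m + 1) * (B * x) + 2 * (int m + 1)) + 2 * (int (Suc m) * B + 1)"
  proof (intro add_mono mult_left_mono)
    show "2 * \<bar>coeff (continuant b (m + 4)) m\<bar> \<le> int m * (int m + 1) * (B * x) + 2 * (int m + 1)"
      using Suc.IH Suc.prems by (simp add: B_def x_def abs_mult eval_nat_numeral)
    show "\<bar>coeff (continuant b (Suc m + 2)) (Suc m)\<bar> \<le> int (Suc m) * B + 1"
      using abs_second_coeff_continuant_le[of "Suc m" b] Suc.prems by (simp add: B_def eval_nat_numeral)
  qed (use pos in auto)
  also have "\<dots> \<le> int (Suc m) * (int (Suc m) + 1) * (B * x * y) + 2 * (int (Suc m) + 1)"
  proof -
    have "B \<le> B * x" using \<open>B \<ge> 1\<close> pos by simp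
    hence "0 \<le> (B * x - 1) * (y - 1) + (B * x - B)" using pos \<open>B \<ge> 1\<close> by auto
    hence "0 \<le> 2 * (int m + 1) * ((B * x - 1) * (y - 1) + (B * x - B))" by simp
    thus ?thesis by (simp add: algebra_simps)
  qed
  also have "B * x * y = \<bar>\<Prod>i<Suc m + 4. b i\<bar>"
    by (simp add: B_def x_def y_def abs_mult eval_nat_numeral)
  finally show ?case .
qed

section \<open>The substitution of X - 1/X\<close>

text \<open>
  Binomial theorem, indexed by the exponent of \<open>X\<close>. The proof follows Pascal's triangle: the exponents
  are written as \<open>k - 2 j\<close>, and the entry above the triangle's edge vanishes by degree.
\<close>

lemma fls_nth_X_minus_X_inv_power:
  "((fls_X - fls_X_inv :: int fls) ^ k) $$ d =
     (if \<bar>d\<bar> \<le> int k \<and> even (int k - d)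
      then (-1) ^ nat ((int k - d) div 2) * int (k choose nat ((int k - d) div 2)) else 0)"
proof -
  let ?w = "\<lambda>k. (fls_X - fls_X_inv :: int fls) ^ k"
  have step: "?w (Suc k) $$ d = ?w k $$ (d - 1) - ?w k $$ (d + 1)" for k d
    by (simp only: power_Suc left_diff_distrib fls_X_times_conv_shift(1) fls_X_inv_times_conv_shift(1))
       simp
  have vanish: "?w k $$ d = 0" if "odd (int k - d) \<or> int k < d" for k d
    using that
  proof (induction k arbitrary: d)
    case (Suc k)
    have "?w k $$ (d - 1) = 0" by (rule Suc.IH) (use Suc.prems in presburger)
    moreover have "?w k $$ (d + 1) = 0" by (rule Suc.IH) (use Suc.prems in presburger)
    ultimately show ?case unfolding step by simp
  next
    case 0
    hence "d \<noteq> 0" by auto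
    thus ?case by simp
  qed
  have binom: "?w k $$ (int k - 2 * int j) = (-1) ^ j * int (k choose j)" for k j
  proof (induction k arbitrary: j)
    case 0
    show ?case by (cases j) auto
  next
    case (Suc k)
    show ?case
    proof (cases j)
      case 0
      have "?w k $$ (int k + 2) = 0" by (rule vanish) auto
      moreover have "?w k $$ int k = 1" using Suc.IH[of 0] by simp
      ultimately have "?w (Suc k) $$ int (Suc k) = 1"
        unfolding step by (simp add: add.commute)
      with 0 show ?thesis by (simp del: power_Suc)
    next
      case (Suc i)
      have shifts: "int (Suc k) - 2 * int j - 1 = int k - 2 * int (Suc i)"
        "int (Suc k) - 2 * int j + 1 = int k - 2 * int i" using Suc by auto
      have "?w (Suc k) $$ (int (Suc k) - 2 * int j) =
               ?w k $$ (int k - 2 * int (Suc i)) - ?w k $$ (int k - 2 * int i)"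
        unfolding step shifts ..
      also have "\<dots> = (-1) ^ j * int (Suc k choose j)"
        unfolding Suc.IH using Suc by (simp add: algebra_simps)
      finally show ?thesis .
    qed
  qed
  show ?thesis
  proof (cases "odd (int k - d) \<or> int k < d")
    case True
    thus ?thesis using vanish[of k d] by auto
  next
    case False
    define j where "j = nat ((int k - d) div 2)"
    have d: "d = int k - 2 * int j" using False by (auto simp: j_def)
    show ?thesis using False binom[of k j] unfolding d by (auto simp: binomial_eq_0 simp del: power_Suc)
  qed
qed

lemma fls_nth_poly:
  "poly (map_poly fls_const (p :: int poly)) f $$ d = (\<Sum>k\<le>degree p. coeff p k * (f ^ k) $$ d)"
proof -
  have "degree (map_poly (fls_const :: int \<Rightarrow> int fls) p) = degree p"
    by (rule degree_map_poly) auto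
  thus ?thesis by (simp add: poly_altdef fls_nth_sum coeff_map_poly)
qed

lemma fls_nth_alternating_laurent:
  "alternating_laurent n a $$ d = (if \<bar>d\<bar> \<le> int n then (-1) ^ nat \<bar>d\<bar> * a (nat \<bar>d\<bar>) else 0)"
proof -
  have summand: "(fls_const ((-1) ^ i * a i) * (fls_X_intpow (int i) + fls_X_intpow (- int i))) $$ d =
       (if i = nat \<bar>d\<bar> then (-1) ^ nat \<bar>d\<bar> * a (nat \<bar>d\<bar>) else 0)" if "i \<in> {1..n}" for i
    using that by auto
  have "alternating_laurent n a $$ d = (if d = 0 then a 0 else 0) +
      (\<Sum>i = 1..n. if i = nat \<bar>d\<bar> then (-1) ^ nat \<bar>d\<bar> * a (nat \<bar>d\<bar>) else 0)"
    unfolding alternating_laurent_def fls_plus_nth fls_nth_sum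
    by (simp only: sum.cong[OF refl summand]) simp
  also have "\<dots> = (if \<bar>d\<bar> \<le> int n then (-1) ^ nat \<bar>d\<bar> * a (nat \<bar>d\<bar>) else 0)"
    by (auto simp: sum.delta')
  finally show ?thesis .
qed

text \<open>
  In terms of \<open>t = X\<^sup>2\<close>, this is the Alexander polynomial up to sign when \<open>p\<close> is the Conway polynomial
  of a knot.
\<close>

definition conway_laurent :: "int poly \<Rightarrow> int fls" where
  "conway_laurent p = poly (map_poly fls_const p) (fls_X - fls_X_inv)"

lemma fls_nth_conway_laurent:
  assumes "degree p \<le> m"
  shows "conway_laurent p $$ d = (\<Sum>k\<le>m. coeff p k * ((fls_X - fls_X_inv) ^ k) $$ d)"
  unfolding conway_laurent_def fls_nth_poly
  by (rule sum.mono_neutral_left) (use assms in \<open>auto simp: coeff_eq_0\<close>)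

lemma conway_laurent_high:
  assumes "degree p \<le> m" "\<bar>d\<bar> > int m"
  shows "conway_laurent p $$ d = 0"
  using assms(2) by (simp add: fls_nth_conway_laurent[OF assms(1)] fls_nth_X_minus_X_inv_power)

lemma conway_laurent_top:
  assumes "degree p \<le> m"
  shows "conway_laurent p $$ int m = coeff p m"
proof -
  have "conway_laurent p $$ int m = (\<Sum>k\<in>{m}. coeff p k * ((fls_X - fls_X_inv) ^ k) $$ int m)"
    unfolding fls_nth_conway_laurent[OF assms]
    by (rule sum.mono_neutral_right) (auto simp: fls_nth_X_minus_X_inv_power)
  thus ?thesis by (simp add: fls_nth_X_minus_X_inv_power)
qed

text \<open>
  Only the powers of \<open>z\<close> with exponents \<open>q\<close>, \<open>q + 2\<close>, \<open>q + 4\<close> contribute to \<open>X\<^sup>q\<close>: lower ones have too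
  small a degree and the other ones the wrong parity.
\<close>

lemma conway_laurent_third:
  assumes "degree p \<le> q + 4"
  shows "conway_laurent p $$ int q =
           coeff p q - (int q + 2) * coeff p (q + 2) + int ((q + 4) choose 2) * coeff p (q + 4)"
proof -
  have "conway_laurent p $$ int q =
      (\<Sum>k\<in>{q, q + 2, q + 4}. coeff p k * ((fls_X - fls_X_inv) ^ k) $$ int q)"
    unfolding fls_nth_conway_laurent[OF assms]
  proof (rule sum.mono_neutral_right)
    show "\<forall>k\<in>{..q + 4} - {q, q + 2, q + 4}. coeff p k * ((fls_X - fls_X_inv) ^ k) $$ int q = 0"
    proof
      fix k assume "k \<in> {..q + 4} - {q, q + 2, q + 4}"
      hence "\<not> (\<bar>int q\<bar> \<le> int k \<and> even (int k - int q))" by auto presburger+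
      thus "coeff p k * ((fls_X - fls_X_inv) ^ k) $$ int q = 0"
        by (simp only: fls_nth_X_minus_X_inv_power if_False mult_zero_right)
    qed
  qed auto
  thus ?thesis by (simp add: fls_nth_X_minus_X_inv_power algebra_simps)
qed

text \<open>
  \<open>X \<mapsto> X\<^sup>-\<^sup>1\<close> changes the sign of \<open>z\<close>, to which a polynomial in \<open>z\<^sup>2\<close> is insensitive.
\<close>

lemma conway_laurent_minus:
  assumes "\<And>k. odd k \<Longrightarrow> coeff p k = 0"
  shows "conway_laurent p $$ (-d) = conway_laurent p $$ d"
proof -
  have "((fls_X - fls_X_inv :: int fls) ^ k) $$ (-d) = ((fls_X - fls_X_inv) ^ k) $$ d"
    if "even k" for k
  proof (cases "\<bar>d\<bar> \<le> int k \<and> even (int k - d)")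
    case True
    define j where "j = nat ((int k - d) div 2)"
    have "int k - d = 2 * int j" using True by (auto simp: j_def abs_le_iff)
    hence "j \<le> k" "nat ((int k + d) div 2) = k - j" using True by auto
    moreover have "(-1 :: int) ^ (k - j) = (-1) ^ j"
      using that \<open>j \<le> k\<close> by (auto simp: minus_one_power_iff)
    ultimately show ?thesis
      using True binomial_symmetric[of j k] by (simp add: fls_nth_X_minus_X_inv_power j_def)
  qed (auto simp: fls_nth_X_minus_X_inv_power)
  thus ?thesis
    unfolding fls_nth_conway_laurent[OF order_refl] using assms
    by (intro sum.cong refl) (metis mult_zero_left)
qed

lemma conway_laurent_odd:
  assumes "\<And>k. odd k \<Longrightarrow> coeff p k = 0" "odd d"
  shows "conway_laurent p $$ d = 0"
proof -
  have "coeff p k * ((fls_X - fls_X_inv) ^ k) $$ d = 0" for k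
    using assms by (cases "even k") (auto simp: fls_nth_X_minus_X_inv_power)
  thus ?thesis unfolding fls_nth_conway_laurent[OF order_refl] by (intro sum.neutral) simp
qed

text \<open>
  The power \<open>z\<^sup>2\<^sup>i\<close> has the coefficients \<open>(-1)^(i - j) (2 i choose (i - j))\<close> at \<open>X\<^sup>2\<^sup>j\<close>. If the coefficients of
  \<open>p\<close> alternate too, all contributions to \<open>X\<^sup>2\<^sup>j\<close> have the sign \<open>(-1)^j\<close>.
\<close>

lemma conway_laurent_alternating_pos:
  assumes "degree p \<le> 2 * n" "\<And>k. odd k \<Longrightarrow> coeff p k = 0"
    and "\<And>i. i \<le> n \<Longrightarrow> (-1) ^ i * coeff p (2 * i) > 0" "j \<le> n"
  shows "(-1) ^ j * conway_laurent p $$ (2 * int j) > 0"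
proof -
  define f where "f k = (-1) ^ j * (coeff p k * ((fls_X - fls_X_inv) ^ k) $$ (2 * int j))" for k
  have pos: "f (2 * i) > 0" if "i \<le> n" "j \<le> i" for i
  proof -
    have "nat ((int (2 * i) - 2 * int j) div 2) = i - j" using that by auto
    hence "f (2 * i) = ((-1) ^ j * (-1) ^ (i - j)) * coeff p (2 * i) * int (2 * i choose (i - j))"
      using that by (simp add: f_def fls_nth_X_minus_X_inv_power)
    also have "\<dots> = ((-1) ^ i * coeff p (2 * i)) * int (2 * i choose (i - j))"
      using that by (simp flip: power_add)
    also have "\<dots> > 0" using assms(3)[OF that(1)] by (rule mult_pos_pos) simp
    finally show ?thesis .
  qed
  have "f k \<ge> 0" if "k \<le> 2 * n" for k
  proof (cases "even k \<and> 2 * j \<le> k")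
    case True
    then obtain i where "k = 2 * i" by blast
    thus ?thesis using pos[of i] that True by simp
  next
    case False
    thus ?thesis using assms(2)[of k] by (auto simp: f_def fls_nth_X_minus_X_inv_power)
  qed
  hence "(\<Sum>k\<le>2 * n. f k) > 0"
    using pos[of j] assms(4) by (intro sum_pos2[of _ "2 * j"]) auto
  thus ?thesis
    unfolding fls_nth_conway_laurent[OF assms(1)] by (simp add: f_def sum_distrib_left)
qed

text \<open>
  Comparing coefficients replaces the signs among the Laurent series by signs among the integers.
\<close>

lemma alexander_polynomial_iff_coefficients:
  "alexander_polynomial nabla K \<Delta> \<longleftrightarrow>
     (\<exists>\<epsilon>\<in>{1, -1}. \<forall>d. (if even d then \<Delta> $$ (d div 2) else 0) = \<epsilon> * conway_laurent (nabla K) $$ d)"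
  (is "_ \<longleftrightarrow> ?R")
proof -
  have "alexander_polynomial nabla K \<Delta> \<longleftrightarrow>
     (\<exists>\<epsilon>\<in>{1, -1}. fls_compose_power \<Delta> 2 = fls_const \<epsilon> * conway_laurent (nabla K))"
    by (auto simp: alexander_polynomial_def conway_laurent_def)
  also have "\<dots> \<longleftrightarrow> ?R" by (simp add: fls_eq_iff fls_nth_compose_power)
  finally show ?thesis .
qed

section \<open>The upper bound\<close>

text \<open>
  The triangle inequality loses nothing in the extremal case, where the three terms have equal sign.
\<close>

lemma abs_third_conway_laurent_le:
  fixes n :: nat and B :: int
  assumes n: "n \<ge> 2" and B: "B = \<bar>\<Prod>i<2 * n. b i\<bar>" "B \<ge> 2" and nz: "\<And>i. i < 2 * n \<Longrightarrow> b i \<noteq> 0"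
  shows "\<bar>conway_laurent (continuant b (2 * n)) $$ (2 * int n - 4)\<bar> \<le>
           (8 * (int n)\<^sup>2 - 15 * int n + 8) * B + 2 * int n - 1"
proof -
  define q where "q = 2 * n - 4"
  have q: "2 * n = q + 4" "2 * int n = int q + 4" using n by (auto simp: q_def)
  define c where "c = coeff (continuant b (2 * n))"
  have c4: "2 * \<bar>c q\<bar> \<le> int q * (int q + 1) * B + 2 * (int q + 1)"
    using abs_third_coeff_continuant_le[of q b] nz by (simp add: c_def B(1) q)
  have c2: "\<bar>c (q + 2)\<bar> \<le> (int q + 2) * B + 1"
  proof -
    have "q + 2 + 2 = q + 4" by simp
    from abs_second_coeff_continuant_le[of "q + 2" b, unfolded this] nz show ?thesis
      by (simp add: c_def B(1) q add.commute)
  qed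
  have c0: "\<bar>c (q + 4)\<bar> = B"
    using coeff_continuant_top[of b "2 * n"] by (simp add: c_def B(1) q)
  have binom: "2 * int ((q + 4) choose 2) = (int q + 4) * (int q + 3)"
  proof -
    have "2 * ((q + 4) choose 2) = (q + 4) * (q + 3)" by (simp add: choose_two)
    thus ?thesis by (metis (no_types, lifting) of_nat_add of_nat_mult of_nat_numeral)
  qed
  have "conway_laurent (continuant b (2 * n)) $$ int q =
      c q - (int q + 2) * c (q + 2) + int ((q + 4) choose 2) * c (q + 4)"
    unfolding c_def by (rule conway_laurent_third) (metis degree_continuant_le q(1))
  also have "2 * \<bar>\<dots>\<bar> \<le> 2 * \<bar>c q\<bar> + 2 * (int q + 2) * \<bar>c (q + 2)\<bar> + 2 * int ((q + 4) choose 2) * \<bar>c (q + 4)\<bar>"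
  proof -
    have "2 * \<bar>u - v + w\<bar> \<le> 2 * \<bar>u\<bar> + 2 * \<bar>v\<bar> + 2 * \<bar>w\<bar>" for u v w :: int
      by arith
    from this[of "c q" "(int q + 2) * c (q + 2)" "int ((q + 4) choose 2) * c (q + 4)"]
    show ?thesis by (simp only: abs_mult mult.assoc) simp
  qed
  also have "\<dots> \<le> (int q * (int q + 1) * B + 2 * (int q + 1)) + 2 * (int q + 2) * ((int q + 2) * B + 1)
                    + (int q + 4) * (int q + 3) * B"
    unfolding binom c0 using c4 c2 by (intro add_mono mult_left_mono) auto
  also have "\<dots> \<le> 2 * ((8 * (int n)\<^sup>2 - 15 * int n + 8) * B + 2 * int n - 1)"
  proof -
    have int_q: "int q = 2 * int n - 4" using q by simp
    \<comment> \<open>This is twice the difference between the claimed bound and the sum of the three estimates.\<close>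
    have "0 \<le> 2 * (int n - 2) * (B - 2)" using n B(2) by simp
    thus ?thesis unfolding int_q by (simp add: algebra_simps power2_eq_square)
  qed
  finally show ?thesis using q by (simp add: algebra_simps)
qed

theorem third_coefficient_le:
  assumes "conway_polynomial nabla" "n \<ge> 2" "two_bridge_knot K"
    and alex: "alexander_polynomial nabla K (alternating_laurent n a)"
    and pos: "\<And>i. i \<le> n \<Longrightarrow> a i > 0" and "a n \<noteq> 1"
  shows "a (n - 2) \<le> (8 * (int n)^2 - 15 * int n + 8) * a n + 2 * int n - 1"
proof -
  obtain bs where bs: "0 \<notin> set bs" "isotopic (two_bridge_diagram bs) K"
    using assms(3) by (auto simp: two_bridge_knot_def)
  define m where "m = length bs"
  define b where "b = (!) bs"
  have nz: "b i \<noteq> 0" if "i < m" for i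
    using bs(1) that by (metis b_def m_def nth_mem)
  let ?L = "conway_laurent (continuant b m)"
  have nabla: "nabla K = continuant b m"
    using conway_polynomial_two_bridge[OF assms(1) bs(2)] by (simp add: b_def m_def)
  obtain \<epsilon> where \<epsilon>: "\<epsilon> \<in> {1, -1}"
    and eq: "\<And>d. (if even d then alternating_laurent n a $$ (d div 2) else 0) = \<epsilon> * ?L $$ d"
    using alex unfolding alexander_polynomial_iff_coefficients nabla by blast
  have top: "?L $$ int m = (\<Prod>i<m. b i)"
    using conway_laurent_top[OF degree_continuant_le] coeff_continuant_top by simp
  have coeffs: "a i = \<bar>?L $$ (2 * int i)\<bar>" if "i \<le> n" for i
  proof -
    have "(-1) ^ i * a i = \<epsilon> * ?L $$ (2 * int i)"
      using eq[of "2 * int i"] that by (simp add: fls_nth_alternating_laurent)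
    hence "\<bar>(-1) ^ i * a i\<bar> = \<bar>\<epsilon> * ?L $$ (2 * int i)\<bar>" by (rule arg_cong)
    thus ?thesis using \<epsilon> pos[OF that] by (auto simp: abs_mult power_abs)
  qed
  \<comment> \<open>The degree in \<open>X\<close> is \<open>m\<close> on one side and \<open>2 n\<close> on the other; in particular an odd number of
    regions cannot occur.\<close>
  have m: "m = 2 * n"
  proof (rule antisym)
    have "\<epsilon> * ?L $$ int m \<noteq> 0" using \<epsilon> nz by (auto simp: top)
    hence "even m" "alternating_laurent n a $$ (int m div 2) \<noteq> 0"
      using eq[of "int m"] by (auto split: if_splits)
    thus "m \<le> 2 * n" by (auto simp: fls_nth_alternating_laurent split: if_splits)
    have "?L $$ (2 * int n) \<noteq> 0" using coeffs[of n] pos[of n] by auto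
    thus "2 * n \<le> m" using conway_laurent_high[OF degree_continuant_le, of m "2 * int n"]
      by force
  qed
  have B: "a n = \<bar>\<Prod>i<2 * n. b i\<bar>" using coeffs[of n] top by (simp add: m)
  have "a n \<ge> 2" using pos[of n] assms(6) by simp
  moreover have "a (n - 2) = \<bar>?L $$ (2 * int n - 4)\<bar>"
    using coeffs[of "n - 2"] assms(2) by (simp add: algebra_simps of_nat_diff)
  ultimately show ?thesis
    using abs_third_conway_laurent_le[OF assms(2) B] nz by (simp add: m)
qed

section \<open>A knot attaining the bound\<close>

text \<open>
  If the signs of the \<open>b\<^sub>i\<close> alternate, starting with \<open>b\<^sub>0 > 0\<close>, the coefficient of \<open>z\<^sup>j\<close> in any continuant of the right parity has the
  sign \<open>(-1)^(j choose 2)\<close>, regardless of \<open>k\<close>. This step shows that in the recursion both terms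
  then have equal sign: passing from \<open>j\<close> to \<open>j + 1\<close> costs \<open>(-1)^j = (-1)^(k + 1)\<close>, the sign of \<open>b\<^sub>k\<^sub>+\<^sub>1\<close>.
\<close>

lemma signed_coeff_continuant_Suc_Suc:
  assumes "odd (k + j)"
  shows "(-1) ^ (Suc j choose 2) * coeff (continuant b (Suc (Suc k))) (Suc j) =
           ((-1) ^ Suc k * b (Suc k)) * ((-1) ^ (j choose 2) * coeff (continuant b (Suc k)) j) +
           (-1) ^ (Suc j choose 2) * coeff (continuant b k) (Suc j)"
proof -
  have "(-1 :: int) ^ (Suc j choose 2) = (-1) ^ j * (-1) ^ (j choose 2)"
    by (simp add: numeral_2_eq_2 power_add)
  also have "(-1 :: int) ^ j = (-1) ^ Suc k"
    using assms by (auto simp: minus_one_power_iff)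
  finally have sign: "(-1 :: int) ^ (Suc j choose 2) = (-1) ^ Suc k * (-1) ^ (j choose 2)" .
  show ?thesis unfolding coeff_continuant_Suc_Suc(1) distrib_left
    by (subst sign) (simp only: mult_ac)
qed

lemma signed_coeff_continuant_pos:
  assumes "\<And>i. (-1) ^ i * b i > 0" "even (k + j)" "j \<le> k"
  shows "(-1) ^ (j choose 2) * coeff (continuant b k) j > 0"
  using assms
proof (induction b k arbitrary: j rule: continuant.induct)
  case (2 b)
  from "2.prems"(2,3) have "j = 1" by (cases j) auto
  thus ?case using "2.prems"(1)[of 0] by (simp add: numeral_2_eq_2)
next
  case (3 b k)
  show ?case
  proof (cases j)
    case 0
    thus ?thesis using 3 by (simp add: coeff_continuant_Suc_Suc)
  next
    case (Suc i)
    have "(-1) ^ (Suc i choose 2) * coeff (continuant b k) (Suc i) \<ge> 0"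
    proof (cases "Suc i \<le> k")
      case True
      thus ?thesis using "3.IH"(2)[of "Suc i"] "3.prems" Suc by simp
    next
      case False
      hence "coeff (continuant b k) (Suc i) = 0"
        using degree_continuant_le[of b k] by (intro coeff_eq_0) auto
      thus ?thesis by simp
    qed
    moreover have "(-1) ^ (i choose 2) * coeff (continuant b (Suc k)) i > 0"
      using "3.IH"(1)[of i] "3.prems" Suc by simp
    hence "((-1) ^ Suc k * b (Suc k)) *
             ((-1) ^ (i choose 2) * coeff (continuant b (Suc k)) i) > 0"
      using "3.prems"(1)[of "Suc k"] by (rule mult_pos_pos[rotated])
    ultimately show ?thesis
      using signed_coeff_continuant_Suc_Suc[of k i b] "3.prems"(2) Suc by simp
  qed
qed (auto simp: numeral_2_eq_2)

text \<open>
  A single factor \<open>2\<close> at one end is the least deviation from the case \<open>a\<^sub>n = 1\<close>; the alternating signs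
  make all contributions to \<open>a\<^sub>n\<^sub>-\<^sub>2\<close> add up.
\<close>

definition extremal_twists :: "nat \<Rightarrow> int" where
  "extremal_twists i = (if i = 0 then 2 else (-1) ^ i)"

lemma extremal_twists_alternate: "(-1) ^ i * extremal_twists i = (if i = 0 then 2 else 1)"
  by (simp add: extremal_twists_def flip: power_mult_distrib)

lemma first_coeff_continuant_extremal:
  "(-1) ^ (Suc m choose 2) * coeff (continuant extremal_twists (Suc m)) (Suc m) = 2"
proof (induction m)
  case 0
  show ?case by (simp add: extremal_twists_def numeral_2_eq_2)
next
  case (Suc m)
  have high: "coeff (continuant extremal_twists m) (Suc (Suc m)) = 0"
    using degree_continuant_le[of extremal_twists m] by (intro coeff_eq_0) auto
  show ?case
    by (subst signed_coeff_continuant_Suc_Suc)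
       (simp_all only: Suc.IH high extremal_twists_alternate, simp_all)
qed

lemma second_coeff_continuant_extremal:
  "(-1) ^ (m choose 2) * coeff (continuant extremal_twists (m + 2)) m = 2 * int m + 1"
proof (induction m)
  case 0
  show ?case by (simp add: numeral_2_eq_2 coeff_continuant_Suc_Suc)
next
  case (Suc m)
  have index: "Suc m + 2 = Suc (Suc (Suc m))" "Suc (Suc m) = m + 2" by simp_all
  have "(-1) ^ (Suc m choose 2) * coeff (continuant extremal_twists (Suc m + 2)) (Suc m) =
      (-1) ^ (m choose 2) * coeff (continuant extremal_twists (m + 2)) m + 2"
    unfolding index(1)
    by (subst signed_coeff_continuant_Suc_Suc)
       (simp_all only: first_coeff_continuant_extremal extremal_twists_alternate index(2), simp_all)
  thus ?case using Suc.IH by simp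
qed

lemma third_coeff_continuant_extremal:
  "(-1) ^ (m choose 2) * coeff (continuant extremal_twists (m + 4)) m = (int m + 1)\<^sup>2"
proof (induction m)
  case 0
  show ?case by (simp add: eval_nat_numeral coeff_continuant_Suc_Suc)
next
  case (Suc m)
  have index: "Suc m + 4 = Suc (Suc (m + 3))" "Suc (m + 3) = m + 4" "m + 3 = Suc m + 2" by simp_all
  have "(-1) ^ (Suc m choose 2) * coeff (continuant extremal_twists (Suc m + 4)) (Suc m) =
      (-1) ^ (m choose 2) * coeff (continuant extremal_twists (m + 4)) m +
      (-1) ^ (Suc m choose 2) * coeff (continuant extremal_twists (m + 3)) (Suc m)"
    unfolding index(1)
    by (subst signed_coeff_continuant_Suc_Suc)
       (simp_all only: extremal_twists_alternate index(2), simp_all)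
  also have "\<dots> = (int m + 1)\<^sup>2 + (2 * int (Suc m) + 1)"
    unfolding Suc.IH index(3) second_coeff_continuant_extremal ..
  also have "\<dots> = (int (Suc m) + 1)\<^sup>2" by (simp add: power2_eq_square algebra_simps)
  finally show ?case .
qed

lemma minus_one_power_choose_two: "(-1 :: int) ^ (2 * i choose 2) = (-1) ^ i"
proof -
  have "2 * i choose 2 = i * (2 * i - 1)" by (simp add: choose_two)
  thus ?thesis by (cases i) (auto simp: minus_one_power_iff binomial_eq_0)
qed

lemma third_conway_laurent_extremal:
  assumes "n \<ge> 2"
  shows "conway_laurent (continuant extremal_twists (2 * n)) $$ (2 * int n - 4) =
           (-1) ^ n * (16 * (int n)\<^sup>2 - 28 * int n + 15)"
proof -
  obtain r where r: "n = r + 2" using assms by (metis add.commute le_Suc_ex)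
  define q where "q = 2 * r"
  have q: "2 * n = q + 4" and int_q: "int q = 2 * int n - 4" by (simp_all add: r q_def)
  define c where "c = coeff (continuant extremal_twists (2 * n))"
  have unsign: "x = (-1) ^ i * y" if "(-1) ^ (2 * i choose 2) * x = y" for i and x y :: int
    using that unfolding minus_one_power_choose_two by (cases "even i") auto
  have "q + 2 + 2 = q + 4" "Suc (q + 3) = q + 4" "q + 2 = 2 * (r + 1)" "q + 4 = 2 * (r + 2)"
    by (simp_all add: q_def)
  note index = this
  have c4: "c q = (-1) ^ r * (int q + 1)\<^sup>2"
    unfolding c_def q using third_coeff_continuant_extremal[of q] by (intro unsign) (simp add: q_def)
  have c2: "c (q + 2) = (-1) ^ (r + 1) * (2 * int (q + 2) + 1)"
    unfolding c_def q using second_coeff_continuant_extremal[of "q + 2", unfolded index(1)]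
    by (intro unsign) (simp only: index)
  have c0: "c (q + 4) = (-1) ^ (r + 2) * 2"
    unfolding c_def q using first_coeff_continuant_extremal[of "q + 3"]
    by (intro unsign) (simp only: index)
  have binom: "int ((q + 4) choose 2) = (2 * int r + 3) * (int r + 2)"
  proof -
    have "(q + 4) choose 2 = (2 * r + 3) * (r + 2)"
      unfolding index(4) by (simp add: choose_two algebra_simps)
    hence "int ((q + 4) choose 2) = int ((2 * r + 3) * (r + 2))" by (rule arg_cong)
    thus ?thesis by (simp add: algebra_simps)
  qed
  have "conway_laurent (continuant extremal_twists (2 * n)) $$ int q =
      c q - (int q + 2) * c (q + 2) + int ((q + 4) choose 2) * c (q + 4)"
    unfolding c_def
    by (rule conway_laurent_third) (metis degree_continuant_le q)
  also have "\<dots> = (-1) ^ n * (16 * (int n)\<^sup>2 - 28 * int n + 15)"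
    unfolding c4 c2 c0 binom by (simp add: q_def r power2_eq_square algebra_simps)
  finally show ?thesis unfolding int_q .
qed

text \<open>
  Twist regions with an even number of crossings return each strand to its place, so the components are
  determined by the closure alone.
\<close>

lemma closed_components_even_twist:
  assumes "i + 1 < length ls"
  shows "closed_components ls k (replicate (2 * N) (i, Cross s) @ D) = closed_components ls k D"
proof (induction N)
  case (Suc N)
  let ?ls = "take i ls @ [ls ! (i + 1), ls ! i] @ drop (i + 2) ls"
  have "take i ?ls @ [?ls ! (i + 1), ?ls ! i] @ drop (i + 2) ?ls = ls"
    using assms by (simp add: nth_append id_take_nth_drop[of i ls, symmetric] Cons_nth_drop_Suc)
  with Suc show ?case by simp
qed simp

lemma closed_components_twisted_strands:
  "closed_components [] 0 (twisted_strands b k @ D) = closed_components [0, 0, 1, 1] 2 D"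
proof (induction k arbitrary: D)
  case 0
  show ?case by (simp add: numeral_2_eq_2)
next
  case (Suc k)
  show ?case by (simp add: Suc.IH closed_components_even_twist twist_position_def)
qed

lemma knot_two_bridge_diagram:
  assumes "even (length bs)"
  shows "knot (two_bridge_diagram bs)"
proof -
  have "closed_components [] 0 (two_bridge_diagram bs) = 1"
    unfolding two_bridge_diagram_conv_twisted_strands closed_components_twisted_strands
    using assms by (simp add: upper_closure_def)
  moreover have "link_diagram (two_bridge_diagram bs)"
    by (simp add: two_bridge_diagram_conv_twisted_strands link_diagram_def orient_append
                  orient_twisted_strands orient_upper_closure)
  ultimately show ?thesis by (simp add: knot_def)
qed

theorem third_coefficient_sharp:
  assumes "conway_polynomial nabla" "n \<ge> 2"
  shows "\<exists>K a. two_bridge_knot K \<and> alexander_polynomial nabla K (alternating_laurent n a) \<and>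
              (\<forall>i\<le>n. a i > 0) \<and> a n \<noteq> 1 \<and>
            a (n - 2) = (8 * (int n)^2 - 15 * int n + 8) * a n + 2 * int n - 1"
proof -
  define bs where "bs = map extremal_twists [0..<2 * n]"
  define K where "K = two_bridge_diagram bs"
  let ?P = "continuant extremal_twists (2 * n)"
  define a where "a i = (-1) ^ i * conway_laurent ?P $$ (2 * int i)" for i
  have knot: "two_bridge_knot K"
    unfolding two_bridge_knot_def K_def
    by (intro exI[of _ bs] conjI knot_two_bridge_diagram)
       (auto simp: bs_def extremal_twists_def isotopic_def)
  have "nabla K = continuant ((!) bs) (length bs)"
    by (rule conway_polynomial_two_bridge[OF assms(1)]) (simp add: K_def isotopic_def)
  also have "\<dots> = ?P" unfolding bs_def length_map length_upt by (simp, intro continuant_cong) simp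
  finally have nabla: "nabla K = ?P" .
  have odd0: "coeff ?P k = 0" if "odd k" for k
    using that by (intro coeff_continuant_odd) auto
  have signs: "(-1) ^ i * extremal_twists i > 0" for i
    by (simp add: extremal_twists_alternate)
  have pos: "a j > 0" if "j \<le> n" for j
    unfolding a_def
  proof (rule conway_laurent_alternating_pos[OF degree_continuant_le odd0 _ that])
    fix i assume "i \<le> n"
    thus "(-1) ^ i * coeff ?P (2 * i) > 0"
      using signed_coeff_continuant_pos[OF signs, of "2 * n" "2 * i"]
      by (simp add: minus_one_power_choose_two)
  qed
  have an: "a n = 2"
  proof -
    have "conway_laurent ?P $$ int (2 * n) = coeff ?P (2 * n)"
      by (rule conway_laurent_top[OF degree_continuant_le])
    moreover have "Suc (2 * n - 1) = 2 * n" using assms(2) by simp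
    hence "(-1) ^ n * coeff ?P (2 * n) = 2"
      using first_coeff_continuant_extremal[of "2 * n - 1"] by (simp only: minus_one_power_choose_two)
    ultimately show ?thesis by (simp add: a_def)
  qed
  have alex: "alexander_polynomial nabla K (alternating_laurent n a)"
    unfolding alexander_polynomial_iff_coefficients nabla
  proof (intro bexI[of _ 1] allI)
    fix d :: int
    show "(if even d then alternating_laurent n a $$ (d div 2) else 0) = 1 * conway_laurent ?P $$ d"
    proof (cases "even d")
      case True
      then obtain e where e: "d = 2 * e" by blast
      have "conway_laurent ?P $$ (2 * \<bar>e\<bar>) = conway_laurent ?P $$ d"
        using conway_laurent_minus[OF odd0, of d] by (auto simp: e abs_if)
      moreover have "conway_laurent ?P $$ d = 0" if "\<bar>e\<bar> > int n"
        by (rule conway_laurent_high[OF degree_continuant_le]) (use that in \<open>auto simp: e\<close>)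
      ultimately show ?thesis by (auto simp: e fls_nth_alternating_laurent a_def)
    qed (simp add: conway_laurent_odd[OF odd0])
  qed simp
  have "a (n - 2) = 16 * (int n)\<^sup>2 - 28 * int n + 15"
  proof -
    have "2 * int (n - 2) = 2 * int n - 4" using assms(2) by (simp add: of_nat_diff)
    moreover have "(-1 :: int) ^ (n - 2) * (-1) ^ n = 1"
      using assms(2) by (auto simp: minus_one_power_iff)
    ultimately show ?thesis
      unfolding a_def by (simp add: third_conway_laurent_extremal[OF assms(2)] flip: mult.assoc)
  qed
  hence "a (n - 2) = (8 * (int n)^2 - 15 * int n + 8) * a n + 2 * int n - 1"
    by (simp add: an)
  with knot alex pos an show ?thesis by (intro exI[of _ K] exI[of _ a]) auto
qed

section \<open>The sharp bound for two-bridge knots\<close>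

theorem theorem5p11:
  fixes nabla :: "diagram \<Rightarrow> int poly" and n :: nat
  assumes "conway_polynomial nabla" and "n \<ge> 2"
  shows "(\<forall>K a. two_bridge_knot K \<and> alexander_polynomial nabla K (alternating_laurent n a) \<and>
              (\<forall>i\<le>n. a i > 0) \<and> a n \<noteq> 1 \<longrightarrow>
            a (n - 2) \<le> (8 * (int n)^2 - 15 * int n + 8) * a n + 2 * int n - 1)
       \<and> (\<exists>K a. two_bridge_knot K \<and> alexander_polynomial nabla K (alternating_laurent n a) \<and>
              (\<forall>i\<le>n. a i > 0) \<and> a n \<noteq> 1 \<and>
            a (n - 2) = (8 * (int n)^2 - 15 * int n + 8) * a n + 2 * int n - 1)"
  using third_coefficient_le[OF assms] third_coefficient_sharp[OF assms] by blast

end
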